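(* Let $n\ge0$ be an integer, $\lambda>0$ and $\alpha=1/\lambda$. If $\alpha<2^{-\frac{1}{n+1}}$, then the equation $$\phi(x)=\frac{\lambda}{2}\bigl(\phi(\lambda x-1)+\phi(\lambda x+1)\bigr)\quad\text{for almost every }x\in\mathbb{R}$$ has no solution $\phi\in C^n_c(\mathbb{R})\setminus\{0\}$.
   Context: $C^n_c(\mathbb{R})$ is the space of compactly supported, $n$ times continuously differentiable complex-valued functions on $\mathbb{R}$ (compactly supported continuous functions if $n=0$). *)

theory Defs
  imports "HOL-Analysis.Analysis"
begin

fun n_times_cont_diff :: "nat \<Rightarrow> (real \<Rightarrow> complex) \<Rightarrow> bool" where
  "n_times_cont_diff 0 f \<longleftrightarrow> continuous_on UNIV f"
| "n_times_cont_diff (Suc n) f \<longleftrightarrow>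
     (\<forall>x. f differentiable (at x)) \<and> n_times_cont_diff n (\<lambda>x. vector_derivative f (at x))"

definition Cc :: "nat \<Rightarrow> (real \<Rightarrow> complex) set" where
  "Cc n = {f. n_times_cont_diff n f \<and> compact (closure (support_on UNIV f))}"

end

theory Submission
  imports Defs
begin

text \<open>
  Put \<open>L = 1 / (lam - 1)\<close>. Suppose a bounded \<open>\<psi>\<close> vanishes far to the right and satisfies
  \<open>\<psi> x = c (\<psi> (lam x - 1) + \<psi> (lam x + 1))\<close> with \<open>norm c > 1\<close>. As \<open>x \<mapsto> lam x - 1\<close> expands
  away from its fixed point \<open>L\<close>, \<open>\<psi>\<close> vanishes on \<open>(L, \<infinity>)\<close>. If \<open>\<psi>\<close> vanishes to the right of \<open>a\<close>,
  then for \<open>a - 2 < L - t \<le> L\<close> one of the two terms drops out and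
  \<open>\<psi> (L - t / lam ^ j) = c ^ j \<psi> (L - t)\<close> for all \<open>j\<close>, so boundedness forces \<open>\<psi> (L - t) = 0\<close>. Hence
  \<open>\<psi> = 0\<close>. Each differentiation multiplies \<open>c\<close> by \<open>lam\<close>, so the \<open>n\<close>-th derivative of a solution
  satisfies the equation with \<open>c = lam ^ (n + 1) / 2 > 1\<close>; it is zero, and so is the solution, by
  compactness of its support.
\<close>

lemma bounded_refinable_eq_0:
  fixes f :: "real \<Rightarrow> complex" and c :: complex and lam R M :: real
  assumes lam: "lam > 1" and c: "norm c > 1"
    and bdd: "\<And>x. norm (f x) \<le> M"
    and R: "\<And>x. x > R \<Longrightarrow> f x = 0"
    and eq: "\<And>x. f x = c * (f (lam * x - 1) + f (lam * x + 1))"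
  shows "f x = 0"
proof -
  define L where "L = 1 / (lam - 1)"
  have L: "lam * L = L + 1"
    using lam by (simp add: L_def field_simps)
  \<comment> \<open>\<open>lam ^ m * (x - L)\<close> is the distance from \<open>L\<close> after
    \<open>m\<close> applications of x \<mapsto> lam x - 1; the hypothesis says that the orbit has
    passed \<open>R\<close> by then. The other argument \<open>lam * x + 1\<close> lies still
    further right, so \<open>shift\<close> serves both.\<close>
  have right: "f x = 0" if "x > L" "lam ^ m * (x - L) > R - L" for x m
    using that
  proof (induction m arbitrary: x)
    case 0
    then show ?case using R by simp
  next
    case (Suc m)
    have shift: "f z = 0" if "z \<ge> lam * x - 1" for z
    proof (rule Suc.IH)
      have le: "lam * (x - L) \<le> z - L"
        using that L by (simp add: algebra_simps)
      moreover have "0 < lam * (x - L)"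
        using lam Suc.prems by simp
      ultimately show "L < z" by linarith
      have "lam ^ m * (lam * (x - L)) \<le> lam ^ m * (z - L)"
        using le lam by (intro mult_left_mono) auto
      then show "R - L < lam ^ m * (z - L)"
        using Suc.prems by (simp add: mult_ac)
    qed
    show ?case
      by (subst eq) (simp add: shift)
  qed
  \<comment> \<open>Points are written as \<open>L - t\<close>. The two arguments in the equation
    differ by 2, so each round extends the zero set of \<open>f\<close> by 2 to the left.\<close>
  have strip: "\<forall>t < 2 * real k. f (L - t) = 0" for k
  proof (induction k)
    case 0
    have "f (L - t) = 0" if t: "t < 0" for t
    proof -
      obtain m where "(R - L) / (- t) < lam ^ m"
        using real_arch_pow[OF lam] by blast
      then show ?thesis
        using t by (intro right[of _ m]) (auto simp: field_simps)
    qed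
    then show ?case by simp
  next
    case (Suc k)
    then have strip_k: "f (L - t) = 0" if "t < 2 * real k" for t
      using that by blast
    have "f (L - t) = 0" if t: "t < 2 * real (Suc k)" for t
    proof (cases "t < 0")
      case True
      then show ?thesis by (intro strip_k) simp
    next
      case False
      \<comment> \<open>At \<open>L - s / lam\<close> the two arguments are \<open>L - s\<close> and
        \<open>L - (s - 2)\<close>. Since 0 \<le> t and lam > 1, s \<le> t < 2k + 2, so the second
        falls in the strip already treated.\<close>
      have scale: "f (L - t / lam ^ j) = c ^ j * f (L - t)" for j
      proof (induction j)
        case (Suc j)
        define s where "s = t / lam ^ j"
        have "s \<le> t / 1"
          unfolding s_def using False lam by (intro divide_left_mono) auto
        then have "f (L - (s - 2)) = 0"
          using t by (intro strip_k) simp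
        moreover have "f (L - s / lam) = c * (f (L - s) + f (L - (s - 2)))"
          using eq[of "L - s / lam"] lam L by (simp add: algebra_simps)
        ultimately show ?case
          using Suc by (simp add: s_def mult_ac)
      qed simp
      show ?thesis
      proof (rule ccontr)
        assume "f (L - t) \<noteq> 0"
        then have pos: "norm (f (L - t)) > 0" by simp
        \<comment> \<open>For this \<open>j\<close> the value at \<open>L - t / lam ^ j\<close>
          exceeds the bound \<open>M\<close>.\<close>
        obtain j where "M / norm (f (L - t)) < norm c ^ j"
          using real_arch_pow[OF c] by blast
        then have "M < norm (c ^ j * f (L - t))"
          using pos by (simp add: norm_mult norm_power field_simps)
        then show False
          using bdd[of "L - t / lam ^ j"] scale by simp
      qed
    qed
    then show ?case by blast
  qed
  obtain k :: nat where "(L - x) / 2 < real k"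
    using reals_Archimedean2 by blast
  then show ?thesis
    using strip[of k, rule_format, of "L - x"] by simp
qed

lemma n_times_cont_diff_imp_continuous_on:
  assumes "n_times_cont_diff n f"
  shows "continuous_on UNIV f"
proof (cases n)
  case (Suc m)
  then show ?thesis
    using assms by (auto intro!: differentiable_imp_continuous_on simp: differentiable_on_def)
qed (use assms in simp)

lemma continuous_compact_support_bounded:
  fixes f :: "real \<Rightarrow> complex"
  assumes cont: "continuous_on UNIV f" and R: "\<And>x. \<bar>x\<bar> > R \<Longrightarrow> f x = 0"
  shows "\<exists>M. \<forall>x. norm (f x) \<le> M"
proof -
  have "compact (f ` {-R..R})"
    using cont continuous_on_subset by (intro compact_continuous_image) auto
  then obtain M where "M > 0" and M: "\<And>y. y \<in> f ` {-R..R} \<Longrightarrow> norm y \<le> M"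
    using compact_imp_bounded bounded_pos by metis
  have "norm (f x) \<le> M" for x
  proof (cases "\<bar>x\<bar> > R")
    case True
    then show ?thesis using R \<open>M > 0\<close> by simp
  next
    case False
    then have "x \<in> {-R..R}" by auto
    then show ?thesis using M by blast
  qed
  then show ?thesis by blast
qed

text \<open>Differentiation lowers \<open>n\<close> by one and replaces \<open>c\<close> by
  \<open>c * lam\<close>, which leaves \<open>norm c * lam ^ n\<close> unchanged; hence the
  induction generalises over \<open>f\<close> and \<open>c\<close>.\<close>

lemma smooth_refinable_eq_0:
  fixes f :: "real \<Rightarrow> complex" and c :: complex and lam R :: real
  assumes lam: "lam > 1"
    and "n_times_cont_diff n f"
    and "\<And>x. \<bar>x\<bar> > R \<Longrightarrow> f x = 0"
    and "\<And>x. f x = c * (f (lam * x - 1) + f (lam * x + 1))"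
    and "norm c * lam ^ n > 1"
  shows "f x = 0"
  using assms(2-)
proof (induction n arbitrary: f c x)
  case 0
  have "continuous_on UNIV f" using 0(1) by simp
  then obtain M where "\<And>x. norm (f x) \<le> M"
    using continuous_compact_support_bounded[of f R] 0(2) by blast
  moreover have "norm c > 1" using 0(4) by simp
  moreover have "f y = 0" if "y > R" for y
    using that by (intro 0(2)) simp
  ultimately show ?case
    using bounded_refinable_eq_0[OF lam _ _ _ 0(3)] by blast
next
  case (Suc n)
  define g where "g = (\<lambda>x. vector_derivative f (at x))"
  have g: "(f has_vector_derivative g x) (at x)" for x
    using Suc.prems(1) by (simp add: g_def vector_derivative_works)
  have "g x = 0" for x
  proof (rule Suc.IH)
    show "n_times_cont_diff n g"
      using Suc.prems(1) by (simp add: g_def)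
    show "g y = 0" if "\<bar>y\<bar> > R" for y
    proof -
      have "open {x::real. \<bar>x\<bar> > R}"
        by (intro open_Collect_less continuous_intros)
      then have "(f has_vector_derivative 0) (at y)"
        using that Suc.prems(2)
        by (intro has_vector_derivative_transform_within_open[OF has_vector_derivative_const]) auto
      then show ?thesis
        by (rule vector_derivative_unique_at[OF g])
    qed
    show "g y = c * of_real lam * (g (lam * y - 1) + g (lam * y + 1))" for y
    proof -
      have comp: "((\<lambda>x. f (lam * x + d)) has_vector_derivative lam *\<^sub>R g (lam * y + d)) (at y)" for d
      proof -
        have "((\<lambda>x. lam * x + d) has_vector_derivative lam) (at y)"
          by (auto intro!: derivative_eq_intros)
        from vector_diff_chain_at[OF this g] show ?thesis
          by (simp add: o_def)
      qed
      \<comment> \<open>The form \<open>+ - 1\<close> makes both summands instances of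
        \<open>comp\<close>.\<close>
      have "((\<lambda>x. c * (f (lam * x + - 1) + f (lam * x + 1))) has_vector_derivative
          c * (lam *\<^sub>R g (lam * y + - 1) + lam *\<^sub>R g (lam * y + 1))) (at y)"
        by (intro has_vector_derivative_mult_right has_vector_derivative_add comp)
      also have "(\<lambda>x. c * (f (lam * x + - 1) + f (lam * x + 1))) = f"
        by (rule ext) (simp add: Suc.prems(3)[symmetric])
      finally have "g y = c * (lam *\<^sub>R g (lam * y + - 1) + lam *\<^sub>R g (lam * y + 1))"
        by (rule vector_derivative_unique_at[OF g])
      then show ?thesis
        by (simp add: scaleR_conv_of_real algebra_simps)
    qed
    show "norm (c * complex_of_real lam) * lam ^ n > 1"
      using Suc.prems(4) lam by (simp add: norm_mult mult_ac)
  qed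
  then have "(f has_vector_derivative 0) (at x within UNIV)" for x
    using g[of x] by simp
  then obtain k where k: "\<And>x. f x = k"
    using has_vector_derivative_zero_constant[of UNIV f] by auto
  \<comment> \<open>The absolute value covers a negative \<open>R\<close>.\<close>
  have "f (\<bar>R\<bar> + 1) = 0"
    by (rule Suc.prems(2)) linarith
  then show ?case using k by simp
qed

text \<open>The coincidence set is closed, and a closed set of full measure is the whole
  line.\<close>

lemma continuous_AE_eq_imp_eq:
  fixes f g :: "real \<Rightarrow> complex"
  assumes "continuous_on UNIV f" "continuous_on UNIV g" "AE x in lborel. f x = g x"
  shows "f x = g x"
proof -
  have "closed {x. f x = g x}"
    using assms by (intro closed_Collect_eq)
  moreover have "AE x\<in>UNIV in lebesgue. x \<in> {x. f x = g x}"
    using AE_completion[OF assms(3)] by simp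
  ultimately have "x \<in> {x. f x = g x}"
    using mem_closed_if_AE_lebesgue_open[of UNIV] by blast
  then show ?thesis by simp
qed

theorem corollary2p4:
  fixes n :: nat and lam alpha :: real
  assumes "lam > 0"
    and "alpha = 1 / lam"
    and "alpha < 2 powr (- (1 / (real n + 1)))"
  shows "\<not> (\<exists>\<phi> \<in> Cc n - {\<lambda>_. 0}.
           AE x in lborel. \<phi> x = complex_of_real (lam / 2) * (\<phi> (lam * x - 1) + \<phi> (lam * x + 1)))"
proof
  assume "\<exists>\<phi> \<in> Cc n - {\<lambda>_. 0}.
    AE x in lborel. \<phi> x = complex_of_real (lam / 2) * (\<phi> (lam * x - 1) + \<phi> (lam * x + 1))"
  then obtain \<phi> where smooth: "n_times_cont_diff n \<phi>"
    and supp: "compact (closure (support_on UNIV \<phi>))" and nz: "\<phi> \<noteq> (\<lambda>_. 0)"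
    and ae: "AE x in lborel. \<phi> x = complex_of_real (lam / 2) * (\<phi> (lam * x - 1) + \<phi> (lam * x + 1))"
    by (auto simp: Cc_def)
  have "alpha > 0" using assms by simp
  \<comment> \<open>Raised to the power n + 1, the hypothesis on \<open>alpha\<close> becomes
    \<open>lam ^ Suc n > 2\<close>. This yields both \<open>lam > 1\<close> and, for c = lam / 2,
    the bound \<open>norm c * lam ^ n > 1\<close>.\<close>
  have "alpha ^ Suc n < (2 powr (- (1 / (real n + 1)))) ^ Suc n"
    using assms \<open>alpha > 0\<close> by (intro power_strict_mono) auto
  also have "\<dots> = 2 powr (- (1 / (real n + 1)) * real (Suc n))"
    by (simp add: powr_powr del: power_Suc of_nat_Suc flip: powr_realpow)
  also have "\<dots> = 1 / 2"
  proof -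
    have exponent: "- (1 / (real n + 1)) * real (Suc n) = - 1"
      by (simp add: field_simps)
    show ?thesis
      unfolding exponent by (simp add: powr_minus)
  qed
  finally have pow: "lam ^ Suc n > 2"
    using assms by (simp add: power_divide field_simps)
  have lam: "lam > 1"
  proof (rule ccontr)
    assume "\<not> lam > 1"
    then have "lam ^ Suc n \<le> 1"
      using assms by (intro power_le_one) auto
    then show False using pow by linarith
  qed
  have cont: "continuous_on UNIV \<phi>"
    using smooth by (rule n_times_cont_diff_imp_continuous_on)
  have "\<phi> x = complex_of_real (lam / 2) * (\<phi> (lam * x - 1) + \<phi> (lam * x + 1))" for x
    by (rule continuous_AE_eq_imp_eq[OF cont _ ae])
      (intro continuous_intros continuous_on_compose2[OF cont] subset_UNIV)
  moreover obtain R where "\<And>x. x \<in> support_on UNIV \<phi> \<Longrightarrow> norm x \<le> R"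
    using compact_imp_bounded[OF supp] closure_subset bounded_iff by (metis subsetD)
  then have "\<phi> x = 0" if "\<bar>x\<bar> > R" for x
    using that by (force simp: support_on_def)
  moreover have "norm (complex_of_real (lam / 2)) * lam ^ n > 1"
    using pow lam by (simp add: norm_divide)
  ultimately have "\<phi> x = 0" for x
    using smooth_refinable_eq_0[OF lam smooth] by blast
  then show False using nz by auto
qed

end
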